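(* Let $m\ge 1$, let $\omega=(w_1,\ldots,w_m)$ be a probability vector, and let $A_1,\ldots,A_m\in \mathrm{UT}_2$. Let $D=\operatorname{diag}(d_1,d_2)=\operatorname{diag}(A_1^{w_1}\cdots A_m^{w_m})$, write $D^{-1}A_i=\begin{bmatrix} a_{11}^{(i)} & a_{12}^{(i)}\\ 0 & a_{22}^{(i)}\end{bmatrix}$ for $i=1,\ldots,m$, and let $c_0=\sum_{i=1}^m w_i\, f\bigl(a_{22}^{(i)}/a_{11}^{(i)},1\bigr)$. Then the Karcher mean $G(\omega;A_1,\ldots,A_m)$ on $\mathrm{UT}_2$, i.e. the unique solution $X\in\mathrm{UT}_2$ of $\sum_{i=1}^m w_i\log(X^{-1}A_i)=0$, exists and is given by $$G(\omega;A_1,\ldots,A_m)=D\exp\left(\frac{1}{c_0}\sum_{i=1}^m w_i\log(D^{-1}A_i)\right).$$ In this formula $D$ can be replaced by any $X_0\in\mathrm{UT}_2$ with $\operatorname{diag}(X_0)=D$; that is, $G(\omega;A_1,\ldots,A_m)=X_0\exp\left(\frac{1}{c_0}\sum_{i=1}^m w_i\log(X_0^{-1}A_i)\right)$ with the same constant $c_0$. More explicitly, $$G(\omega;A_1,\ldots,A_m)=\begin{bmatrix} d_1 & \dfrac{d_1\sum_{i=1}^m w_i\, f\bigl(a_{22}^{(i)},a_{11}^{(i)}\bigr)\,a_{12}^{(i)}}{\sum_{i=1}^m w_i\, f\bigl(a_{22}^{(i)},a_{11}^{(i)}\bigr)\,a_{22}^{(i)}}\\ 0 & d_2\end{bmat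rix}.$$
   Context: $\mathrm{UT}_2$ is the group of $2\times 2$ real upper triangular matrices with positive diagonal entries. A probability vector has nonnegative entries summing to $1$. For $A\in\mathrm{UT}_2$, $\log A$ is the principal logarithm (the unique real upper triangular matrix $L$ with $\exp L=A$), and $A^{p}=\exp(p\log A)$ for $p\in\mathbb{R}$. $\operatorname{diag}(A)$ is the diagonal matrix formed from the diagonal entries of $A$, and $\operatorname{diag}(d_1,d_2)$ is the diagonal matrix with the given entries. For $x,y>0$, $f(x,y)=\dfrac{\log x-\log y}{x-y}$ if $x\neq y$, and $f(x,x)=1/x$. The Karcher mean $G(\omega;A_1,\ldots,A_m)$ is defined, when it exists uniquely, as the solution $X$ of the Karcher equation $\sum_i w_i\log(X^{-1}A_i)=0$. *)

theory Defs
  imports "HOL-Analysis.Analysis"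
begin

(* On the type real^2^2 the operations *, ^ and inverse act entrywise, so matrix products,
   powers and inverses below are always written with **, mpow and matrix_inv. *)

primrec mpow :: "real^2^2 \<Rightarrow> nat \<Rightarrow> real^2^2" where
  "mpow A 0 = mat 1"
| "mpow A (Suc k) = A ** mpow A k"

definition mexp :: "real^2^2 \<Rightarrow> real^2^2" where
  "mexp A = (\<Sum>k. (1 / fact k) *\<^sub>R mpow A k)"

definition upper_triangular2 :: "real^2^2 \<Rightarrow> bool" where
  "upper_triangular2 A \<longleftrightarrow> A $ 2 $ 1 = 0"

definition UT2 :: "(real^2^2) set" where
  "UT2 = {A. upper_triangular2 A \<and> 0 < A $ 1 $ 1 \<and> 0 < A $ 2 $ 2}"

(* Only meaningful for A in UT2, as are mpowr and the notions built on them. *)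
definition mlog :: "real^2^2 \<Rightarrow> real^2^2" where
  "mlog A = (THE L. upper_triangular2 L \<and> mexp L = A)"

definition mpowr :: "real^2^2 \<Rightarrow> real \<Rightarrow> real^2^2" where
  "mpowr A p = mexp (p *\<^sub>R mlog A)"

definition mat2 :: "real \<Rightarrow> real \<Rightarrow> real \<Rightarrow> real \<Rightarrow> real^2^2" where
  "mat2 a b c d = vector [vector [a, b], vector [c, d]]"

definition diag2 :: "real \<Rightarrow> real \<Rightarrow> real^2^2" where
  "diag2 d\<^sub>1 d\<^sub>2 = mat2 d\<^sub>1 0 0 d\<^sub>2"

definition diag_part :: "real^2^2 \<Rightarrow> real^2^2" where
  "diag_part A = diag2 (A $ 1 $ 1) (A $ 2 $ 2)"

definition logdiff :: "real \<Rightarrow> real \<Rightarrow> real" where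
  "logdiff x y = (if x = y then 1 / x else (ln x - ln y) / (x - y))"

definition probability_vector :: "nat \<Rightarrow> (nat \<Rightarrow> real) \<Rightarrow> bool" where
  "probability_vector m w \<longleftrightarrow> (\<forall>i\<in>{1..m}. 0 \<le> w i) \<and> (\<Sum>i=1..m. w i) = 1"

primrec mprod :: "nat \<Rightarrow> (nat \<Rightarrow> real^2^2) \<Rightarrow> real^2^2" where
  "mprod 0 B = mat 1"
| "mprod (Suc m) B = mprod m B ** B (Suc m)"

definition karcher_equation ::
  "nat \<Rightarrow> (nat \<Rightarrow> real) \<Rightarrow> (nat \<Rightarrow> real^2^2) \<Rightarrow> real^2^2 \<Rightarrow> bool" where
  "karcher_equation m w A X \<longleftrightarrow> (\<Sum>i=1..m. w i *\<^sub>R mlog (matrix_inv X ** A i)) = 0"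

definition karcher_mean ::
  "nat \<Rightarrow> (nat \<Rightarrow> real) \<Rightarrow> (nat \<Rightarrow> real^2^2) \<Rightarrow> real^2^2" where
  "karcher_mean m w A = (THE X. X \<in> UT2 \<and> karcher_equation m w A X)"

end

theory Submission
  imports Defs
begin

text \<open>
  On upper triangular matrices \<open>mexp\<close> and \<open>mlog\<close> are explicit: they act by \<open>exp\<close> and \<open>ln\<close> on the
  diagonal and multiply the off-diagonal entry by a divided difference. Hence the diagonal of the
  Karcher equation forces the diagonal of \<open>X\<close> to be the weighted geometric mean, and after that
  the remaining entry is linear in the off-diagonal entry of \<open>X\<close>. The vanishing of the weighted
  sum of \<open>ln (a i $ 2 $ 2) - ln (a i $ 1 $ 1)\<close> identifies the coefficient of this linear
  equation with \<open>c\<^sub>0 > 0\<close>.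
\<close>

section \<open>Entrywise calculus of 2x2 matrices\<close>

lemma mat2_nth [simp]:
  "mat2 a b c d $ 1 $ 1 = a" "mat2 a b c d $ 1 $ 2 = b"
  "mat2 a b c d $ 2 $ 1 = c" "mat2 a b c d $ 2 $ 2 = d"
  by (simp_all add: mat2_def)

lemma matrix_2_2_eq_iff:
  "A = B \<longleftrightarrow> A $ 1 $ 1 = B $ 1 $ 1 \<and> A $ 1 $ 2 = B $ 1 $ 2 \<and> A $ 2 $ 1 = B $ 2 $ 1
    \<and> A $ 2 $ 2 = B $ 2 $ 2" for A B :: "real^2^2"
  by (auto simp: vec_eq_iff forall_2)

lemma mat2_inject [simp]:
  "mat2 a b c d = mat2 a' b' c' d' \<longleftrightarrow> a = a' \<and> b = b' \<and> c = c' \<and> d = d'"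
  by (auto simp: matrix_2_2_eq_iff)

lemma mat2_eq_0_iff [simp]: "mat2 a b c d = 0 \<longleftrightarrow> a = 0 \<and> b = 0 \<and> c = 0 \<and> d = 0"
  by (simp add: matrix_2_2_eq_iff)

lemma upper_triangular2_eq_mat2:
  "upper_triangular2 A \<Longrightarrow> A = mat2 (A $ 1 $ 1) (A $ 1 $ 2) 0 (A $ 2 $ 2)"
  by (simp add: matrix_2_2_eq_iff upper_triangular2_def)

lemma upper_triangular2_mat2 [simp]: "upper_triangular2 (mat2 a b 0 d)"
  by (simp add: upper_triangular2_def)

lemma mat2_in_UT2 [simp]: "mat2 a b 0 d \<in> UT2 \<longleftrightarrow> 0 < a \<and> 0 < d"
  by (simp add: UT2_def)

lemma UT2_cases:
  assumes "A \<in> UT2"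
  obtains a b d where "A = mat2 a b 0 d" "0 < a" "0 < d"
  using assms upper_triangular2_eq_mat2[of A] by (auto simp: UT2_def)

lemma mat_1_eq_mat2: "mat 1 = mat2 1 0 0 1"
  by (simp add: matrix_2_2_eq_iff mat_def)

lemma mat2_mult:
  "mat2 a b c d ** mat2 a' b' c' d'
    = mat2 (a * a' + b * c') (a * b' + b * d') (c * a' + d * c') (c * b' + d * d')"
  by (simp add: matrix_2_2_eq_iff matrix_matrix_mult_def sum_2)

lemma scaleR_mat2: "r *\<^sub>R mat2 a b c d = mat2 (r * a) (r * b) (r * c) (r * d)"
  by (simp add: matrix_2_2_eq_iff)

lemma sum_mat2:
  "(\<Sum>i\<in>I. mat2 (f i) (g i) (h i) (k i))
    = mat2 (\<Sum>i\<in>I. f i) (\<Sum>i\<in>I. g i) (\<Sum>i\<in>I. h i) (\<Sum>i\<in>I. k i)"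
  by (simp add: matrix_2_2_eq_iff)

lemma mat2_sums:
  assumes "f sums F" "g sums G" "h sums H" "k sums K"
  shows "(\<lambda>n. mat2 (f n) (g n) (h n) (k n)) sums mat2 F G H K"
  unfolding sums_def
proof (intro vec_tendstoI)
  fix i j :: 2
  show "(\<lambda>n. (\<Sum>l<n. mat2 (f l) (g l) (h l) (k l)) $ i $ j) \<longlonglongrightarrow> mat2 F G H K $ i $ j"
    using assms exhaust_2[of i] exhaust_2[of j] by (auto simp: sums_def)
qed

lemma matrix_inv_upper:
  assumes "a \<noteq> 0" "d \<noteq> 0"
  shows "matrix_inv (mat2 a b 0 d) = mat2 (1 / a) (- b / (a * d)) 0 (1 / d)"
proof -
  let ?A = "mat2 a b 0 d" and ?B = "mat2 (1 / a) (- b / (a * d)) 0 (1 / d)"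
  have AB: "?A ** ?B = mat 1" and BA: "?B ** ?A = mat 1"
    using assms by (simp_all add: mat2_mult mat_1_eq_mat2 matrix_2_2_eq_iff field_simps)
  show ?thesis
    unfolding matrix_inv_def
  proof (rule some_equality)
    show "?A ** ?B = mat 1 \<and> ?B ** ?A = mat 1"
      using AB BA by simp
    \<comment> \<open>\<open>matrix_inv\<close> is a choice among two-sided inverses, so its value
      is known only once they are shown to coincide:
      \<open>B = B ** (?A ** ?B) = (B ** ?A) ** ?B = ?B\<close>.\<close>
    show "B = ?B" if "?A ** B = mat 1 \<and> B ** ?A = mat 1" for B
      using that AB by (metis matrix_mul_assoc matrix_mul_lid matrix_mul_rid)
  qed
qed

section \<open>Exponential and logarithm of upper triangular matrices\<close>

definition expdiff :: "real \<Rightarrow> real \<Rightarrow> real" where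
  "expdiff x y = (if x = y then exp x else (exp x - exp y) / (x - y))"

text \<open>The factor of \<open>b\<close> is the divided difference of t^k at \<open>a\<close> and
  \<open>d\<close>, which becomes the derivative when \<open>a = d\<close>. At \<open>k = 0\<close>
  the truncated exponent \<open>k - 1\<close> is harmless because the factor \<open>k\<close>
  vanishes.\<close>

lemma mpow_upper:
  "mpow (mat2 a b 0 d) k
    = mat2 (a ^ k) (b * (if a = d then k * a ^ (k - 1) else (a ^ k - d ^ k) / (a - d))) 0 (d ^ k)"
proof (induction k)
  case 0
  then show ?case by (simp add: mat_1_eq_mat2)
next
  case (Suc k)
  show ?case
  proof (cases "a = d")
    case True
    then show ?thesis
      unfolding mpow.simps Suc.IH mat2_mult
      by (cases k) (simp_all add: matrix_2_2_eq_iff algebra_simps)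
  next
    case False
    then show ?thesis
      unfolding mpow.simps Suc.IH mat2_mult by (simp add: matrix_2_2_eq_iff field_simps)
  qed
qed

lemma exp_sums: "(\<lambda>n. 1 / fact n * x ^ n) sums exp x" for x :: real
  using exp_converges[of x] by (simp add: field_simps)

lemma exp_deriv_sums: "(\<lambda>n. 1 / fact n * (n * x ^ (n - 1))) sums exp x" for x :: real
proof -
  have "1 / fact (Suc n) * (real (Suc n) * x ^ (Suc n - 1)) = 1 / fact n * x ^ n" for n
    by (simp add: divide_simps del: of_nat_Suc)
  then have "(\<lambda>n. 1 / fact (Suc n) * (real (Suc n) * x ^ (Suc n - 1))) sums exp x"
    using exp_sums[of x] by (simp only:)
  \<comment> \<open>The series above is the tail of the termwise differentiated exponential series;
    the missing term at \<open>n = 0\<close> is zero.\<close>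
  then show ?thesis
    using sums_Suc_imp[of "\<lambda>n. 1 / fact n * (n * x ^ (n - 1))"] by simp
qed

text \<open>Divided differences are linear in the function, so summing those of t^k / k! yields the
  divided difference of exp.\<close>

lemma mexp_upper: "mexp (mat2 a b 0 d) = mat2 (exp a) (b * expdiff a d) 0 (exp d)"
proof -
  let ?q = "\<lambda>k. if a = d then k * a ^ (k - 1) else (a ^ k - d ^ k) / (a - d)"
  have "(\<lambda>k. 1 / fact k * ?q k) sums expdiff a d"
  proof (cases "a = d")
    case True
    then show ?thesis
      using exp_deriv_sums[of a] by (simp add: expdiff_def)
  next
    case False
    then show ?thesis
      using sums_divide[OF sums_diff[OF exp_sums[of a] exp_sums[of d]], of "a - d"]
      by (simp add: expdiff_def algebra_simps diff_divide_distrib)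
  qed
  then have "(\<lambda>k. b * (1 / fact k * ?q k)) sums (b * expdiff a d)"
    by (rule sums_mult)
  then have "(\<lambda>k. 1 / fact k * (b * ?q k)) sums (b * expdiff a d)"
    by (simp only: mult.left_commute)
  then have "(\<lambda>k. (1 / fact k) *\<^sub>R mpow (mat2 a b 0 d) k)
      sums mat2 (exp a) (b * expdiff a d) 0 (exp d)"
    unfolding mpow_upper scaleR_mat2 by (intro mat2_sums exp_sums) auto
  then show ?thesis
    unfolding mexp_def by (rule sums_unique[symmetric])
qed

lemma logdiff_commute: "logdiff x y = logdiff y x"
  by (simp add: logdiff_def) (metis minus_diff_eq minus_divide_divide)

lemma logdiff_pos: "0 < x \<Longrightarrow> 0 < y \<Longrightarrow> 0 < logdiff x y"
  by (auto simp: logdiff_def zero_less_divide_iff)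

lemma logdiff_mult_diff: "logdiff x y * (x - y) = ln x - ln y"
  by (simp add: logdiff_def)

text \<open>Homogeneity of degree -1. It rewrites the summands of \<open>c\<^sub>0\<close> in terms
  of \<open>logdiff (a i $ 2 $ 2) (a i $ 1 $ 1)\<close>, the factor in the explicit formula.\<close>

lemma logdiff_divide_1:
  assumes "0 < x" "0 < y"
  shows "logdiff (x / y) 1 = logdiff x y * y"
  using assms by (simp add: logdiff_def ln_div field_simps)

text \<open>The two difference quotients are reciprocal because \<open>exp (ln x) = x\<close>. This
  makes the off-diagonal entries of logarithm and exponential invert each other.\<close>

lemma logdiff_mult_expdiff_ln:
  assumes "0 < x" "0 < y"
  shows "logdiff x y * expdiff (ln x) (ln y) = 1"
  using assms by (simp add: logdiff_def expdiff_def)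

lemma mlog_upper:
  assumes "0 < a" "0 < d"
  shows "mlog (mat2 a b 0 d) = mat2 (ln a) (b * logdiff a d) 0 (ln d)"
  unfolding mlog_def
proof (rule the_equality)
  have *: "logdiff a d * expdiff (ln a) (ln d) = 1"
    using assms by (rule logdiff_mult_expdiff_ln)
  then show "upper_triangular2 (mat2 (ln a) (b * logdiff a d) 0 (ln d)) \<and>
      mexp (mat2 (ln a) (b * logdiff a d) 0 (ln d)) = mat2 a b 0 d"
    using assms by (simp add: mexp_upper mult.assoc)
  fix L
  assume L: "upper_triangular2 L \<and> mexp L = mat2 a b 0 d"
  define x y z where "x = L $ 1 $ 1" "y = L $ 1 $ 2" "z = L $ 2 $ 2"
  have Leq: "L = mat2 x y 0 z"
    using L upper_triangular2_eq_mat2 by (simp add: x_y_z_def)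
  then have "mat2 (exp x) (y * expdiff x z) 0 (exp z) = mat2 a b 0 d"
    using L mexp_upper by simp
  then have "exp x = a" "y * expdiff x z = b" "exp z = d"
    by (simp_all add: matrix_2_2_eq_iff)
  moreover from this have "x = ln a" "z = ln d"
    by auto
  \<comment> \<open>With the diagonal of \<open>L\<close> known, multiplying the off-diagonal
    equation by \<open>logdiff a d\<close> cancels \<open>expdiff\<close> and solves for
    \<open>y\<close>.\<close>
  moreover have "y * expdiff (ln a) (ln d) * logdiff a d = y"
    using * by (simp add: mult.assoc mult.commute[of "logdiff a d"])
  ultimately show "L = mat2 (ln a) (b * logdiff a d) 0 (ln d)"
    by (simp add: Leq matrix_2_2_eq_iff)
qed

section \<open>Weighted products and the left-hand side of the Karcher equation\<close>

lemma mprod_mpowr_upper: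
  assumes "\<forall>i\<in>{1..m}. A i \<in> UT2"
  shows "\<exists>b. mprod m (\<lambda>i. mpowr (A i) (w i))
    = mat2 (exp (\<Sum>i=1..m. w i * ln (A i $ 1 $ 1))) b 0 (exp (\<Sum>i=1..m. w i * ln (A i $ 2 $ 2)))"
  using assms
proof (induction m)
  case 0
  then show ?case by (auto simp: mat_1_eq_mat2)
next
  case (Suc m)
  then obtain b where b: "mprod m (\<lambda>i. mpowr (A i) (w i))
    = mat2 (exp (\<Sum>i=1..m. w i * ln (A i $ 1 $ 1))) b 0 (exp (\<Sum>i=1..m. w i * ln (A i $ 2 $ 2)))"
    by auto
  have "A (Suc m) \<in> UT2"
    using Suc.prems by simp
  then obtain p q r where A: "A (Suc m) = mat2 p q 0 r" and pr: "0 < p" "0 < r"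
    by (rule UT2_cases)
  have "mpowr (A (Suc m)) (w (Suc m)) =
      mat2 (exp (w (Suc m) * ln p)) (w (Suc m) * (q * logdiff p r)
        * expdiff (w (Suc m) * ln p) (w (Suc m) * ln r)) 0 (exp (w (Suc m) * ln r))"
    using pr by (simp add: A mpowr_def mlog_upper scaleR_mat2 mexp_upper)
  then have "mprod (Suc m) (\<lambda>i. mpowr (A i) (w i)) =
      mat2 (exp (\<Sum>i=1..m. w i * ln (A i $ 1 $ 1)) * exp (w (Suc m) * ln p))
        (mprod (Suc m) (\<lambda>i. mpowr (A i) (w i)) $ 1 $ 2) 0
        (exp (\<Sum>i=1..m. w i * ln (A i $ 2 $ 2)) * exp (w (Suc m) * ln r))"
    by (simp only: mprod.simps b mat2_mult mat2_nth) simp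
  then show ?case
    by (auto simp: A exp_add)
qed

lemma mlog_inv_mult:
  assumes "0 < x" "0 < z" "0 < p" "0 < r"
  shows "mlog (matrix_inv (mat2 x y 0 z) ** mat2 p q 0 r)
    = mat2 (ln p - ln x) (logdiff (r / z) (p / x) * (q / x - y / x * (r / z))) 0 (ln r - ln z)"
  using assms
  by (simp add: matrix_inv_upper mat2_mult mlog_upper ln_div matrix_2_2_eq_iff
      logdiff_commute[of "p / x" "r / z"] mult.commute)

lemma weighted_sum_diff_const:
  assumes "probability_vector m w"
  shows "(\<Sum>i=1..m. w i * (f i - c)) = (\<Sum>i=1..m. w i * f i) - c"
  using assms by (simp add: probability_vector_def right_diff_distrib sum_subtractf
      sum_distrib_right[symmetric])

text \<open>As the weights sum to 1, \<open>ln x\<close> and \<open>ln z\<close> leave the sums.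
  Keeping \<open>x\<close> and \<open>z\<close> arbitrary lets the uniqueness argument read off the
  diagonal of a solution before it is known.\<close>

lemma sum_mlog_inv_mult:
  assumes w: "probability_vector m w"
    and A: "\<forall>i\<in>{1..m}. A i \<in> UT2"
    and x: "0 < x" and z: "0 < z"
  shows "(\<Sum>i=1..m. w i *\<^sub>R mlog (matrix_inv (mat2 x y 0 z) ** A i))
    = mat2 ((\<Sum>i=1..m. w i * ln (A i $ 1 $ 1)) - ln x)
        (\<Sum>i=1..m. w i * logdiff (A i $ 2 $ 2 / z) (A i $ 1 $ 1 / x)
          * (A i $ 1 $ 2 / x - y / x * (A i $ 2 $ 2 / z)))
        0 ((\<Sum>i=1..m. w i * ln (A i $ 2 $ 2)) - ln z)"
proof -
  have "(\<Sum>i=1..m. w i *\<^sub>R mlog (matrix_inv (mat2 x y 0 z) ** A i))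
    = (\<Sum>i=1..m. mat2 (w i * (ln (A i $ 1 $ 1) - ln x))
        (w i * logdiff (A i $ 2 $ 2 / z) (A i $ 1 $ 1 / x)
          * (A i $ 1 $ 2 / x - y / x * (A i $ 2 $ 2 / z)))
        0 (w i * (ln (A i $ 2 $ 2) - ln z)))"
  proof (intro sum.cong refl)
    fix i
    assume "i \<in> {1..m}"
    then have "A i \<in> UT2"
      using A by blast
    then obtain p q r where "A i = mat2 p q 0 r" "0 < p" "0 < r"
      by (rule UT2_cases)
    then show "w i *\<^sub>R mlog (matrix_inv (mat2 x y 0 z) ** A i)
      = mat2 (w i * (ln (A i $ 1 $ 1) - ln x))
        (w i * logdiff (A i $ 2 $ 2 / z) (A i $ 1 $ 1 / x)
          * (A i $ 1 $ 2 / x - y / x * (A i $ 2 $ 2 / z)))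
        0 (w i * (ln (A i $ 2 $ 2) - ln z))"
      using x z by (simp add: mlog_inv_mult scaleR_mat2 mult.assoc)
  qed
  then show ?thesis
    by (simp only: sum_mat2 weighted_sum_diff_const[OF w] sum.neutral_const)
qed

section \<open>Solution of the Karcher equation\<close>

theorem theorem2p5:
  fixes m :: nat and w :: "nat \<Rightarrow> real" and A :: "nat \<Rightarrow> real^2^2"
    and D :: "real^2^2" and d\<^sub>1 d\<^sub>2 c\<^sub>0 :: real
    and a :: "nat \<Rightarrow> real^2^2"
  assumes "m \<ge> 1"
    and "probability_vector m w"
    and "\<And>i. i \<in> {1..m} \<Longrightarrow> A i \<in> UT2"
    and "D = diag_part (mprod m (\<lambda>i. mpowr (A i) (w i)))"
    and "D = diag2 d\<^sub>1 d\<^sub>2"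
    and "\<And>i. a i = matrix_inv D ** A i"
    and "c\<^sub>0 = (\<Sum>i=1..m. w i * logdiff (a i $ 2 $ 2 / a i $ 1 $ 1) 1)"
  shows "(\<forall>i\<in>{1..m}. a i \<in> UT2) \<and> c\<^sub>0 \<noteq> 0
    \<and> (\<Sum>i=1..m. w i * logdiff (a i $ 2 $ 2) (a i $ 1 $ 1) * a i $ 2 $ 2) \<noteq> 0
    \<and> (\<exists>!X. X \<in> UT2 \<and> karcher_equation m w A X)
    \<and> karcher_mean m w A =
        D ** mexp ((1 / c\<^sub>0) *\<^sub>R (\<Sum>i=1..m. w i *\<^sub>R mlog (matrix_inv D ** A i)))
    \<and> (\<forall>X\<^sub>0\<in>UT2. diag_part X\<^sub>0 = D \<longrightarrow>
        karcher_mean m w A =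
          X\<^sub>0 ** mexp ((1 / c\<^sub>0) *\<^sub>R (\<Sum>i=1..m. w i *\<^sub>R mlog (matrix_inv X\<^sub>0 ** A i))))
    \<and> karcher_mean m w A =
        mat2 d\<^sub>1
          (d\<^sub>1 * (\<Sum>i=1..m. w i * logdiff (a i $ 2 $ 2) (a i $ 1 $ 1) * a i $ 1 $ 2) /
            (\<Sum>i=1..m. w i * logdiff (a i $ 2 $ 2) (a i $ 1 $ 1) * a i $ 2 $ 2))
          0 d\<^sub>2"
proof -
  have A: "\<forall>i\<in>{1..m}. A i \<in> UT2"
    using assms(3) by blast
  define s\<^sub>1 s\<^sub>2 where "s\<^sub>1 = (\<Sum>i=1..m. w i * ln (A i $ 1 $ 1))"
    and "s\<^sub>2 = (\<Sum>i=1..m. w i * ln (A i $ 2 $ 2))"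
  \<comment> \<open>\<open>D\<close> sees only the diagonal of the product, so the off-diagonal
    entry \<open>b\<close> can be discarded.\<close>
  obtain b where "mprod m (\<lambda>i. mpowr (A i) (w i)) = mat2 (exp s\<^sub>1) b 0 (exp s\<^sub>2)"
    using mprod_mpowr_upper[OF A, of w] unfolding s\<^sub>1_def s\<^sub>2_def by auto
  then have "mat2 d\<^sub>1 0 0 d\<^sub>2 = mat2 (exp s\<^sub>1) 0 0 (exp s\<^sub>2)"
    using assms(4,5) by (simp add: diag_part_def diag2_def)
  then have d: "d\<^sub>1 = exp s\<^sub>1" "d\<^sub>2 = exp s\<^sub>2"
    by simp_all
  then have dpos: "0 < d\<^sub>1" "0 < d\<^sub>2"
    by simp_all
  have D: "D = mat2 d\<^sub>1 0 0 d\<^sub>2"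
    using assms(5) by (simp add: diag2_def)

  have a: "a i = mat2 (A i $ 1 $ 1 / d\<^sub>1) (A i $ 1 $ 2 / d\<^sub>1) 0 (A i $ 2 $ 2 / d\<^sub>2)"
    if "i \<in> {1..m}" for i
  proof -
    obtain p q r where "A i = mat2 p q 0 r"
      using assms(3)[OF \<open>i \<in> {1..m}\<close>] by (elim UT2_cases)
    then show ?thesis
      using dpos by (simp add: assms(6) D matrix_inv_upper mat2_mult)
  qed
  have aUT: "a i \<in> UT2" if "i \<in> {1..m}" for i
    using assms(3)[OF that] dpos by (simp add: a[OF that] UT2_def)
  then have apos: "0 < a i $ 1 $ 1" "0 < a i $ 2 $ 2" if "i \<in> {1..m}" for i
    using that by (simp_all add: UT2_def)

  \<comment> \<open>\<open>N\<close> and \<open>c\<close> will be the constant term and the slope of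
    the linear equation for the off-diagonal entry of \<open>X\<close>.\<close>
  define l where "l i = logdiff (a i $ 2 $ 2) (a i $ 1 $ 1)" for i
  define N where "N = (\<Sum>i=1..m. w i * l i * a i $ 1 $ 2)"
  define c where "c = (\<Sum>i=1..m. w i * l i * a i $ 2 $ 2)"
  \<comment> \<open>By homogeneity \<open>c\<^sub>0\<close> is the sum with
    \<open>a i $ 1 $ 1\<close> in place of \<open>a i $ 2 $ 2\<close>. The difference from
    \<open>c\<close> telescopes through \<open>logdiff_mult_diff\<close> into weighted sums of
    logarithms, which vanish since \<open>d\<^sub>1\<close> and \<open>d\<^sub>2\<close> are
    weighted geometric means.\<close>
  have "c - (\<Sum>i=1..m. w i * l i * a i $ 1 $ 1)
      = (\<Sum>i=1..m. w i * (l i * (a i $ 2 $ 2 - a i $ 1 $ 1)))"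
    unfolding c_def by (simp add: sum_subtractf algebra_simps)
  also have "\<dots> = (\<Sum>i=1..m. w i * (ln (A i $ 2 $ 2) - ln d\<^sub>2) - w i * (ln (A i $ 1 $ 1) - ln d\<^sub>1))"
  proof (intro sum.cong refl)
    fix i
    assume i: "i \<in> {1..m}"
    then show "w i * (l i * (a i $ 2 $ 2 - a i $ 1 $ 1))
        = w i * (ln (A i $ 2 $ 2) - ln d\<^sub>2) - w i * (ln (A i $ 1 $ 1) - ln d\<^sub>1)"
      using assms(3)[OF i] dpos unfolding l_def logdiff_mult_diff a[OF i]
      by (simp add: ln_div UT2_def algebra_simps)
  qed
  also have "\<dots> = 0"
    unfolding sum_subtractf weighted_sum_diff_const[OF assms(2)]
    by (simp add: d s\<^sub>1_def s\<^sub>2_def)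
  finally have c0: "c\<^sub>0 = c"
    using apos by (simp add: assms(7) l_def logdiff_divide_1 mult.assoc)

  have lpos: "0 < l i * a i $ 2 $ 2" if "i \<in> {1..m}" for i
    using apos[OF that] by (simp add: l_def logdiff_pos)
  have w: "0 \<le> w i" if "i \<in> {1..m}" for i
    using assms(2) that by (simp add: probability_vector_def)
  \<comment> \<open>Weights may be zero, so positivity of \<open>c\<close> needs one index with
    positive weight.\<close>
  have "\<exists>i\<in>{1..m}. w i \<noteq> 0"
    using assms(2) by (metis probability_vector_def sum.neutral zero_neq_one)
  then obtain i where i: "i \<in> {1..m}" "0 < w i"
    using w by (metis order_less_le)
  have cpos: "0 < c"
    unfolding c_def
  proof (rule sum_pos2[of _ i])
    show "0 < w i * l i * a i $ 2 $ 2"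
      using i lpos[OF i(1)] by (simp add: mult.assoc)
    show "0 \<le> w j * l j * a j $ 2 $ 2" if "j \<in> {1..m}" for j
      using w[OF that] lpos[OF that] by (simp add: mult.assoc)
  qed (use i in auto)

  have log_sum: "(\<Sum>i=1..m. w i *\<^sub>R mlog (matrix_inv (mat2 d\<^sub>1 y 0 d\<^sub>2) ** A i))
      = mat2 0 (N - y / d\<^sub>1 * c) 0 0" for y
  proof -
    have "(\<Sum>i=1..m. w i * logdiff (A i $ 2 $ 2 / d\<^sub>2) (A i $ 1 $ 1 / d\<^sub>1)
          * (A i $ 1 $ 2 / d\<^sub>1 - y / d\<^sub>1 * (A i $ 2 $ 2 / d\<^sub>2)))
        = (\<Sum>i=1..m. w i * l i * a i $ 1 $ 2 - y / d\<^sub>1 * (w i * l i * a i $ 2 $ 2))"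
      by (intro sum.cong refl) (simp add: l_def a algebra_simps)
    also have "\<dots> = N - y / d\<^sub>1 * c"
      by (simp only: sum_subtractf N_def c_def sum_distrib_left)
    finally show ?thesis
      unfolding sum_mlog_inv_mult[OF assms(2) A dpos]
      by (simp add: d s\<^sub>1_def s\<^sub>2_def)
  qed

  \<comment> \<open>The off-diagonal entry is the unique zero \<open>y\<close> of
    \<open>N - y / d\<^sub>1 * c\<close>.\<close>
  define G where "G = mat2 d\<^sub>1 (d\<^sub>1 * N / c) 0 d\<^sub>2"
  have sol: "X \<in> UT2 \<and> karcher_equation m w A X \<longleftrightarrow> X = G" for X
  proof
    assume "X = G"
    then show "X \<in> UT2 \<and> karcher_equation m w A X"
      using dpos cpos unfolding G_def karcher_equation_def by (simp add: log_sum del: One_nat_def)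
  next
    assume X: "X \<in> UT2 \<and> karcher_equation m w A X"
    then obtain x y z where Xeq: "X = mat2 x y 0 z" and xz: "0 < x" "0 < z"
      by (blast elim: UT2_cases)
    have sum0: "(\<Sum>i=1..m. w i *\<^sub>R mlog (matrix_inv (mat2 x y 0 z) ** A i)) = 0"
      using X by (simp add: Xeq karcher_equation_def)
    then have "s\<^sub>1 = ln x" "s\<^sub>2 = ln z"
      unfolding sum_mlog_inv_mult[OF assms(2) A xz]
      by (simp_all add: s\<^sub>1_def s\<^sub>2_def)
    \<comment> \<open>The diagonal equations do not involve \<open>y\<close>; they fix
      \<open>x\<close> and \<open>z\<close>, and only then does \<open>log_sum\<close>
      apply.\<close>
    then have xz_eq: "x = d\<^sub>1" "z = d\<^sub>2"
      using xz by (simp_all add: d)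
    then have "N - y / d\<^sub>1 * c = 0"
      using sum0 by (simp add: log_sum del: One_nat_def)
    then show "X = G"
      using dpos cpos by (simp add: G_def Xeq xz_eq field_simps)
  qed
  then have mean: "karcher_mean m w A = G"
    by (simp add: karcher_mean_def)

  \<comment> \<open>The log sum has zero diagonal, so its scaled exponential is the identity plus
    the off-diagonal entry \<open>(N - y / d\<^sub>1 * c) / c\<close>. Multiplying on the left adds
    \<open>y\<close> to \<open>d\<^sub>1\<close> times this entry, and \<open>y\<close> cancels:
    hence any \<open>X\<^sub>0\<close> with diagonal \<open>D\<close> serves.\<close>
  have formula: "mat2 d\<^sub>1 y 0 d\<^sub>2 **
      mexp ((1 / c\<^sub>0) *\<^sub>R (\<Sum>i=1..m. w i *\<^sub>R mlog (matrix_inv (mat2 d\<^sub>1 y 0 d\<^sub>2) ** A i))) = G" for y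
    using dpos cpos
    by (simp add: log_sum c0 scaleR_mat2 mexp_upper mat2_mult expdiff_def G_def field_simps
        del: One_nat_def)
  have formula': "X\<^sub>0 ** mexp ((1 / c\<^sub>0) *\<^sub>R (\<Sum>i=1..m. w i *\<^sub>R mlog (matrix_inv X\<^sub>0 ** A i))) = G"
    if "X\<^sub>0 \<in> UT2" "diag_part X\<^sub>0 = D" for X\<^sub>0
  proof -
    have "X\<^sub>0 = mat2 d\<^sub>1 (X\<^sub>0 $ 1 $ 2) 0 d\<^sub>2"
      using that
      by (auto simp: UT2_def upper_triangular2_def diag_part_def diag2_def D matrix_2_2_eq_iff)
    then obtain y where "X\<^sub>0 = mat2 d\<^sub>1 y 0 d\<^sub>2"
      by blast
    then show ?thesis
      by (simp only: formula)
  qed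
  show ?thesis
    using aUT sol formula[of 0] formula' cpos
    unfolding mean c0 l_def[symmetric] N_def[symmetric] c_def[symmetric] D[symmetric]
    by (auto simp: G_def simp del: One_nat_def)
qed

end
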